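(* Let $d\in\mathbb{N}$ and let $f:\mathbb{N}^d\to\mathbb{N}$ be a semigroup homomorphism (for the additive structures). For any finite partition of $\mathbb{N}^d$ and any $k\in\mathbb{N}$ there exist $a,b\in\mathbb{N}^d$ such that the set $$\{b\}\cup\Big\{a+\big(i_1f(b),\dots,i_df(b)\big):0\leq i_1,\dots,i_d\leq k\Big\}$$ (the $i_j$ being integers) is contained in a single cell of the partition.
   Context: $\mathbb{N}=\{1,2,\dots\}$ with addition. A semigroup homomorphism is a map $f$ between commutative semigroups with $f(a+b)=f(a)+f(b)$ for all $a,b$. *)

theory Defs
  imports "HOL-Analysis.Finite_Cartesian_Product" "HOL-Library.Disjoint_Sets" "HOL-Library.FuncSet"
begin

text \<open>The natural numbers start at 1 here, so the positive integers and their powers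
  are carrier sets inside \<^typ>\<open>nat\<close> and \<^typ>\<open>nat ^ 'd\<close>.\<close>

definition pos_nats :: "nat set" where
  "pos_nats = {1..}"

definition pos_vecs :: "(nat ^ 'd) set" where
  "pos_vecs = {x. \<forall>j. x $ j \<in> pos_nats}"

definition semigroup_hom_on ::
  "'a::ab_semigroup_add set \<Rightarrow> 'b::ab_semigroup_add set \<Rightarrow> ('a \<Rightarrow> 'b) \<Rightarrow> bool" where
  "semigroup_hom_on A B f \<longleftrightarrow> f \<in> A \<rightarrow> B \<and> (\<forall>x\<in>A. \<forall>y\<in>A. f (x + y) = f x + f y)"

end

theory Submission
  imports Defs
begin

text \<open>Induction on the number of colours, as in the classical derivation of Brauer's theorem from
  van der Waerden's. Suppose the finite set \<open>W\<close> suffices for \<open>r\<close> colours. Gallai's theorem yields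
  \<open>a\<close> and \<open>D\<close> such that \<open>a + D (i\<^sub>1 f(y), \<dots>, i\<^sub>d f(y))\<close> has a single colour \<open>c\<close> for all \<open>y \<in> W\<close> and
  all \<open>i \<le> k\<close>. Since \<open>D f(y) = f(D y)\<close>, either some \<open>b = D y\<close> has the colour \<open>c\<close>, which is the
  required configuration, or the dilate \<open>D W\<close> misses \<open>c\<close> and the induction hypothesis applies to
  it. Gallai's theorem is proved by colour focusing.\<close>

section \<open>Gallai's theorem by colour focusing\<close>

definition mono_homothet :: "((nat ^ 'd) \<Rightarrow> nat) \<Rightarrow> (nat ^ 'd) set \<Rightarrow> nat ^ 'd \<Rightarrow> nat \<Rightarrow> nat \<Rightarrow> bool" where
  "mono_homothet col F a D c \<longleftrightarrow> (\<forall>u\<in>F. col (a + D *s u) = c)"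

text \<open>A compactness form: one finite stock of pairs serves all \<open>r\<close>-colourings at
  once, so that the points involved can later be collected in finite sets.\<close>

definition gallai_set :: "(nat ^ 'd) set \<Rightarrow> nat \<Rightarrow> ((nat ^ 'd) \<times> nat) set \<Rightarrow> bool" where
  "gallai_set F r A \<longleftrightarrow> finite A \<and> A \<subseteq> UNIV \<times> {1..} \<and>
     (\<forall>col. (\<forall>x. col x < r) \<longrightarrow> (\<exists>(a, D)\<in>A. \<exists>c. mono_homothet col F a D c))"

text \<open>\<open>v\<close> is the point to be added to \<open>F\<close>. Each colour in
  \<open>Q\<close> has a spoke, a copy of \<open>F\<close> in that colour, and all these spokes
  would send \<open>v\<close> to the same focus \<open>e\<close>, whose own colour is left
  open.\<close>

definition focused ::
  "((nat ^ 'd) \<Rightarrow> nat) \<Rightarrow> (nat ^ 'd) set \<Rightarrow> nat ^ 'd \<Rightarrow> ((nat ^ 'd) \<times> nat) set \<Rightarrow> nat ^ 'd \<Rightarrow> nat set \<Rightarrow> bool"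
  where
  "focused col F v A e Q \<longleftrightarrow>
     (\<forall>c\<in>Q. \<exists>(a, D)\<in>A. a + D *s v = e \<and> mono_homothet col F a D c)"

lemma focused_mono_homothet:
  assumes "focused col F v A e Q" "col e \<in> Q"
  shows "\<exists>(a, D)\<in>A. mono_homothet col (insert v F) a D (col e)"
  using assms unfolding focused_def mono_homothet_def by fastforce

text \<open>Focusing colours points by functions, namely the colour patterns on translates of a
  finite set. Numbering \<open>T\<close> reduces such colours to numbers.\<close>

lemma gallai_finite_colours:
  fixes F :: "(nat ^ 'd) set"
  assumes "\<And>r. \<exists>A. gallai_set F r A" and "finite T"
  shows "\<exists>A. finite A \<and> A \<subseteq> UNIV \<times> {1..} \<and>
     (\<forall>\<psi>. range \<psi> \<subseteq> T \<longrightarrow> (\<exists>(a, D)\<in>A. \<forall>u\<in>F. \<forall>u'\<in>F. \<psi> (a + D *s u) = \<psi> (a + D *s u')))"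
proof -
  obtain h where h: "bij_betw h T {0..<card T}"
    using ex_bij_betw_finite_nat[OF \<open>finite T\<close>] by blast
  obtain A where A: "gallai_set F (card T) A" using assms(1) by blast
  show ?thesis
  proof (intro exI[of _ A] conjI allI impI)
    fix \<psi> :: "nat ^ 'd \<Rightarrow> 'a" assume \<psi>: "range \<psi> \<subseteq> T"
    have "\<forall>x. h (\<psi> x) < card T"
      using h \<psi> unfolding bij_betw_def by (metis atLeastLessThan_iff image_eqI rangeI subset_eq)
    then obtain a D c where "(a, D) \<in> A" and m: "mono_homothet (\<lambda>x. h (\<psi> x)) F a D c"
      using A unfolding gallai_set_def by (auto dest!: spec[of _ "\<lambda>x. h (\<psi> x)"])
    moreover have "\<psi> (a + D *s u) = \<psi> (a + D *s u')" if "u \<in> F" "u' \<in> F" for u u'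
      using m that inj_onD[OF bij_betw_imp_inj_on[OF h]] \<psi> unfolding mono_homothet_def
      by (metis rangeI subset_eq)
    ultimately show "\<exists>(a, D)\<in>A. \<forall>u\<in>F. \<forall>u'\<in>F. \<psi> (a + D *s u) = \<psi> (a + D *s u')" by blast
  qed (use A in \<open>auto simp: gallai_set_def\<close>)
qed

text \<open>Here \<open>s\<close> counts the spokes: each round adds one of a new colour, unless a
  full copy of \<open>insert v F\<close> appears.\<close>

lemma gallai_focusing:
  fixes F :: "(nat ^ 'd) set" and v :: "nat ^ 'd"
  assumes G: "\<And>r. \<exists>A. gallai_set F r A" and "finite F" "F \<noteq> {}"
  shows "\<exists>A E. finite A \<and> finite E \<and> A \<subseteq> UNIV \<times> {1..} \<and>
    (\<forall>col. (\<forall>x. col x < r) \<longrightarrow>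
      (\<exists>(a, D)\<in>A. \<exists>c. mono_homothet col (insert v F) a D c) \<or>
      (\<exists>e\<in>E. \<exists>Q. Q \<subseteq> {..<r} \<and> card Q = s \<and> focused col F v A e Q))"
proof (induction s)
  case 0
  show ?case
    by (intro exI[of _ "{}"] exI[of _ "{0}"]) (auto simp: focused_def)
next
  case (Suc s)
  then obtain A E where fin: "finite A" "finite E" and A: "A \<subseteq> UNIV \<times> {1..}"
    and foc: "\<And>col. (\<forall>x. col x < r) \<Longrightarrow>
      (\<exists>(a, D)\<in>A. \<exists>c. mono_homothet col (insert v F) a D c) \<or>
      (\<exists>e\<in>E. \<exists>Q. Q \<subseteq> {..<r} \<and> card Q = s \<and> focused col F v A e Q)"
    by metis
  \<comment> \<open>\<open>W\<close> holds every point that the configurations of the previous round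
    can involve, so its colour pattern in a translate determines which of them occur there.\<close>
  define W where "W = (\<lambda>((a, D), u). a + D *s u) ` (A \<times> insert v F) \<union> E"
  have finW: "finite W" unfolding W_def using fin \<open>finite F\<close> by auto
  have WA: "a + D *s u \<in> W" if "(a, D) \<in> A" "u \<in> insert v F" for a D u
    using that unfolding W_def by force
  have WE: "e \<in> W" if "e \<in> E" for e using that unfolding W_def by auto
  have finT: "finite (W \<rightarrow>\<^sub>E {..<r})" using finW by (intro finite_PiE) auto
  obtain B where finB: "finite B" and B: "B \<subseteq> UNIV \<times> {1..}"
    and gal: "\<And>\<psi>. range \<psi> \<subseteq> (W \<rightarrow>\<^sub>E {..<r}) \<Longrightarrow>
      \<exists>(a, D)\<in>B. \<forall>u\<in>F. \<forall>u'\<in>F. \<psi> (a + D *s u) = \<psi> (a + D *s u')"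
    using gallai_finite_colours[OF G finT] by blast
  \<comment> \<open>\<open>A1\<close> serves the old spokes after tilting, \<open>A2\<close> the
    case of a full copy inside a translate, and \<open>A3\<close> the new spoke, made of the
    translates of an old focus. \<open>E'\<close> holds the new foci.\<close>
  define A1 where "A1 = (\<lambda>((a, D), (a', D')). (a + a', D + D')) ` (B \<times> A)"
  define A2 where "A2 = (\<lambda>(((a, D), u), (a', D')). (a + D *s u + a', D')) ` ((B \<times> F) \<times> A)"
  define A3 where "A3 = (\<lambda>((a, D), e). (a + e, D)) ` (B \<times> E)"
  define E' where "E' = (\<lambda>((a, D), e). a + e + D *s v) ` (B \<times> E)"
  have A1I: "(a + a', D + D') \<in> A1" if "(a, D) \<in> B" "(a', D') \<in> A" for a D a' D'
    using that unfolding A1_def by force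
  have A2I: "(a + D *s u + a', D') \<in> A2" if "(a, D) \<in> B" "u \<in> F" "(a', D') \<in> A" for a D u a' D'
    using that unfolding A2_def by force
  have A3I: "(a + e, D) \<in> A3" if "(a, D) \<in> B" "e \<in> E" for a D e
    using that unfolding A3_def by force
  have E'I: "a + e + D *s v \<in> E'" if "(a, D) \<in> B" "e \<in> E" for a D e
    using that unfolding E'_def by force
  show ?case
  proof (intro exI[of _ "A1 \<union> A2 \<union> A3"] exI[of _ E'] conjI allI impI)
    show "finite (A1 \<union> A2 \<union> A3)" "finite E'"
      unfolding A1_def A2_def A3_def E'_def using fin finB \<open>finite F\<close> by auto
    show "A1 \<union> A2 \<union> A3 \<subseteq> UNIV \<times> {1..}"
      unfolding A1_def A2_def A3_def using A B by fastforce
    fix col :: "nat ^ 'd \<Rightarrow> nat" assume col: "\<forall>x. col x < r"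
    \<comment> \<open>Equal \<open>\<psi>\<close>-colours mean that the translates of \<open>W\<close> are coloured identically, so that the spokes
      in these translates can be tilted by \<open>D\<close> towards the common focus \<open>a + e + D *s v\<close>.\<close>
    define \<psi> where "\<psi> = (\<lambda>x. restrict (\<lambda>w. col (x + w)) W)"
    have "range \<psi> \<subseteq> (W \<rightarrow>\<^sub>E {..<r})" using col unfolding \<psi>_def by auto
    then obtain a D where aD: "(a, D) \<in> B"
      and \<psi>_same: "\<forall>u\<in>F. \<forall>u'\<in>F. \<psi> (a + D *s u) = \<psi> (a + D *s u')"
      using gal by blast
    have same: "col (a + D *s u + w) = col (a + D *s u' + w)"
      if "u \<in> F" "u' \<in> F" "w \<in> W" for u u' w
    proof -
      have "\<psi> (a + D *s u) = \<psi> (a + D *s u')" using \<psi>_same that(1,2) by blast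
      then have "\<psi> (a + D *s u) w = \<psi> (a + D *s u') w" by (rule fun_cong)
      then show ?thesis using that(3) by (simp add: \<psi>_def)
    qed
    obtain u0 where u0: "u0 \<in> F" using \<open>F \<noteq> {}\<close> by blast
    \<comment> \<open>The translates of \<open>W\<close> by \<open>a + D *s u\<close> with
      \<open>u \<in> F\<close> are coloured alike; \<open>t\<close> represents them all.\<close>
    define t where "t = a + D *s u0"
    have tr: "col (a + D *s u + w) = col (t + w)" if "u \<in> F" "w \<in> W" for u w
      using same[OF that(1) u0 that(2)] by (simp add: t_def)
    have lift: "\<exists>(a, D)\<in>A1 \<union> A2 \<union> A3. \<exists>c. mono_homothet col (insert v F) a D c"
      if "\<exists>(a, D)\<in>A. \<exists>c. mono_homothet (\<lambda>x. col (t + x)) (insert v F) a D c"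
    proof -
      from that obtain a' D' c where "(a', D') \<in> A"
        "mono_homothet (\<lambda>x. col (t + x)) (insert v F) a' D' c" by blast
      then have "(t + a', D') \<in> A2" "mono_homothet col (insert v F) (t + a') D' c"
        using A2I[OF aD u0] by (auto simp: t_def mono_homothet_def add.assoc)
      then show ?thesis by blast
    qed
    show "(\<exists>(a, D)\<in>A1 \<union> A2 \<union> A3. \<exists>c. mono_homothet col (insert v F) a D c) \<or>
      (\<exists>e\<in>E'. \<exists>Q. Q \<subseteq> {..<r} \<and> card Q = Suc s \<and> focused col F v (A1 \<union> A2 \<union> A3) e Q)"
    proof (cases "\<exists>(a, D)\<in>A. \<exists>c. mono_homothet (\<lambda>x. col (t + x)) (insert v F) a D c")
      case True
      then show ?thesis using lift by blast
    next
      case False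
      then obtain e Q where e: "e \<in> E" and Q: "Q \<subseteq> {..<r}" "card Q = s"
        and f: "focused (\<lambda>x. col (t + x)) F v A e Q"
        using foc[of "\<lambda>x. col (t + x)"] col by blast
      \<comment> \<open>Otherwise the focus would complete the spoke of its own colour to a full
        copy of \<open>insert v F\<close>.\<close>
      have new: "col (t + e) \<notin> Q"
        using focused_mono_homothet[OF f] False by blast
      have "focused col F v (A1 \<union> A2 \<union> A3) (a + e + D *s v) (insert (col (t + e)) Q)"
        unfolding focused_def
      proof
        fix c assume "c \<in> insert (col (t + e)) Q"
        then consider "c = col (t + e)" | "c \<in> Q" by blast
        then show "\<exists>(a', D')\<in>A1 \<union> A2 \<union> A3. a' + D' *s v = a + e + D *s v \<and> mono_homothet col F a' D' c"
        proof cases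
          case 1
          have "mono_homothet col F (a + e) D c"
            using tr[OF _ WE[OF e]] 1 by (simp add: mono_homothet_def add.assoc add.commute add.left_commute)
          then show ?thesis using A3I[OF aD e] by blast
        next
          case 2
          then obtain a' D' where a'D': "(a', D') \<in> A" "a' + D' *s v = e"
            and m: "mono_homothet (\<lambda>x. col (t + x)) F a' D' c"
            using f unfolding focused_def by blast
          \<comment> \<open>The tilted spoke takes its point for \<open>u\<close> from the translate
            by \<open>a + D *s u\<close>, where it is coloured as in the translate by
            \<open>t\<close>.\<close>
          have split: "a + a' + (D + D') *s u = a + D *s u + (a' + D' *s u)" for u
            by (simp add: vec_eq_iff algebra_simps)
          have "mono_homothet col F (a + a') (D + D') c"
            using m tr WA[OF a'D'(1)] unfolding mono_homothet_def split by simp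
          moreover have "a + a' + (D + D') *s v = a + e + D *s v"
            using a'D'(2) unfolding split by (simp add: add_ac)
          ultimately show ?thesis using A1I[OF aD a'D'(1)] by blast
        qed
      qed
      moreover have "insert (col (t + e)) Q \<subseteq> {..<r}" "card (insert (col (t + e)) Q) = Suc s"
        using Q col new finite_subset[OF Q(1)] by auto
      ultimately show ?thesis using E'I[OF aD e] by blast
    qed
  qed
qed

text \<open>Induction on the points of \<open>F\<close>, for all \<open>r\<close> at once, since
  focusing applies the smaller case to patterns, which need many more colours.\<close>

theorem gallai:
  fixes F :: "(nat ^ 'd) set"
  assumes "finite F"
  shows "\<exists>A. gallai_set F r A"
proof (cases "F = {}")
  case True
  then show ?thesis
    by (intro exI[of _ "{(0, 1)}"]) (simp add: gallai_set_def mono_homothet_def)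
next
  case False
  with assms show ?thesis
  proof (induction F arbitrary: r rule: finite_ne_induct)
    case (singleton u)
    show ?case
      by (intro exI[of _ "{(0, 1)}"]) (simp add: gallai_set_def mono_homothet_def)
  next
    case (insert v F)
    obtain A E where A: "finite A" "A \<subseteq> UNIV \<times> {1..}"
      and foc: "\<And>col. (\<forall>x. col x < r) \<Longrightarrow>
        (\<exists>(a, D)\<in>A. \<exists>c. mono_homothet col (insert v F) a D c) \<or>
        (\<exists>e\<in>E. \<exists>Q. Q \<subseteq> {..<r} \<and> card Q = r \<and> focused col F v A e Q)"
      using gallai_focusing[where s = r and r = r and v = v, OF insert.IH] insert.hyps by metis
    have "\<exists>(a, D)\<in>A. \<exists>c. mono_homothet col (insert v F) a D c" if col: "\<forall>x. col x < r" for col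
      using foc[OF col]
    proof
      assume "\<exists>e\<in>E. \<exists>Q. Q \<subseteq> {..<r} \<and> card Q = r \<and> focused col F v A e Q"
      then obtain e Q where Q: "Q \<subseteq> {..<r}" "card Q = r" and f: "focused col F v A e Q" by blast
      \<comment> \<open>With \<open>r\<close> spokes every colour is taken, so the colour of the
        focus agrees with that of some spoke.\<close>
      have "Q = {..<r}" using Q by (simp add: card_subset_eq)
      then show ?thesis using focused_mono_homothet[OF f] col by blast
    qed
    then show ?case using A unfolding gallai_set_def by blast
  qed
qed

section \<open>Configurations, dilations and the Brauer argument\<close>

definition mono_config ::
  "((nat ^ 'd) \<Rightarrow> nat) \<Rightarrow> ((nat ^ 'd) \<Rightarrow> nat) \<Rightarrow> nat \<Rightarrow> nat ^ 'd \<Rightarrow> nat ^ 'd \<Rightarrow> bool" where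
  "mono_config col f k a b \<longleftrightarrow> a \<in> pos_vecs \<and> b \<in> pos_vecs \<and>
     (\<forall>i. (\<forall>j. i j \<le> k) \<longrightarrow> col (a + (\<chi> j. i j * f b)) = col b)"

lemma pos_vecs_add: "x \<in> pos_vecs \<Longrightarrow> x + y \<in> pos_vecs"
  by (simp add: pos_vecs_def pos_nats_def trans_le_add1)

lemma pos_vecs_scale: "x \<in> pos_vecs \<Longrightarrow> 1 \<le> D \<Longrightarrow> D *s x \<in> pos_vecs"
  by (simp add: pos_vecs_def pos_nats_def Suc_le_eq)

lemma one_pos_vecs: "1 \<in> pos_vecs"
  by (simp add: pos_vecs_def pos_nats_def)

lemma semigroup_hom_scale:
  assumes "semigroup_hom_on pos_vecs pos_nats f" "x \<in> pos_vecs" "1 \<le> D"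
  shows "f (D *s x) = D * f x"
  using \<open>1 \<le> D\<close>
proof (induction D rule: nat_induct_at_least)
  case base
  then show ?case by (simp add: vec_eq_iff vector_scalar_mult_def)
next
  case (Suc n)
  have "Suc n *s x = x + n *s x" by (simp add: vec_eq_iff)
  then show ?case
    using assms(1,2) Suc pos_vecs_scale[OF assms(2) Suc.hyps] by (simp add: semigroup_hom_on_def)
qed

text \<open>\<open>f\<close> commutes with dilations, so a configuration found for the colouring of
  a dilate can be carried back to \<open>col\<close>.\<close>

lemma mono_config_scale:
  assumes "semigroup_hom_on pos_vecs pos_nats f" "1 \<le> D"
    and m: "mono_config (\<lambda>x. col (D *s x)) f k a b"
  shows "mono_config col f k (D *s a) (D *s b)"
proof -
  have b: "b \<in> pos_vecs" using m by (simp add: mono_config_def)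
  have "D *s a + (\<chi> j. i j * f (D *s b)) = D *s (a + (\<chi> j. i j * f b))" for i :: "'a \<Rightarrow> nat"
    using semigroup_hom_scale[OF assms(1) b assms(2)] by (simp add: vec_eq_iff algebra_simps)
  then show ?thesis
    using m pos_vecs_scale assms(2) by (auto simp: mono_config_def)
qed

lemma finite_box_vecs: "finite {x :: nat ^ 'd. \<forall>j. x $ j \<le> m}"
proof -
  have "{x :: nat ^ 'd. \<forall>j. x $ j \<le> m} \<subseteq> vec_lambda ` (UNIV \<rightarrow>\<^sub>E {..m})"
  proof
    fix x :: "nat ^ 'd" assume "x \<in> {x. \<forall>j. x $ j \<le> m}"
    then show "x \<in> vec_lambda ` (UNIV \<rightarrow>\<^sub>E {..m})"
      by (intro image_eqI[of _ _ "vec_nth x"]) auto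
  qed
  then show ?thesis by (rule finite_subset) (simp add: finite_PiE)
qed

text \<open>Only the colours of the finite set \<open>W\<close> are required to lie in \<open>S\<close>: the induction restricts
  the palette on a dilate of \<open>W\<close>, not on all of \<open>pos_vecs\<close>.\<close>

lemma brauer_colours:
  fixes f :: "nat ^ 'd \<Rightarrow> nat"
  assumes f: "semigroup_hom_on pos_vecs pos_nats f"
  shows "\<exists>W \<subseteq> pos_vecs. finite W \<and>
    (\<forall>col S. (\<forall>x\<in>pos_vecs. col x < n) \<longrightarrow> finite S \<longrightarrow> card S = r \<longrightarrow> col ` W \<subseteq> S \<longrightarrow>
      (\<exists>a b. mono_config col f k a b))"
proof (induction r)
  case 0
  show ?case
    \<comment> \<open>A nonempty \<open>W\<close> cannot be coloured from an empty palette, so this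
      case is vacuous.\<close>
    using one_pos_vecs by (intro exI[of _ "{1}"]) auto
next
  case (Suc r)
  then obtain W where W: "W \<subseteq> pos_vecs" "finite W"
    and IH: "\<And>col S. \<forall>x\<in>pos_vecs. col x < n \<Longrightarrow> finite S \<Longrightarrow> card S = r \<Longrightarrow> col ` W \<subseteq> S \<Longrightarrow>
      \<exists>a b. mono_config col f k a b"
    by metis
  \<comment> \<open>The box contains all offsets \<open>(\<chi> j. i j * f y)\<close> with
    \<open>y \<in> W\<close>, before the dilation by \<open>D\<close>.\<close>
  define F where "F = {x :: nat ^ 'd. \<forall>j. x $ j \<le> k * Max (f ` W)}"
  have zeroF: "0 \<in> F" unfolding F_def by simp
  have inF: "(\<chi> j. i j * f y) \<in> F" if "y \<in> W" "\<forall>j. i j \<le> k" for y i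
    using that W unfolding F_def by (auto intro!: mult_mono)
  have finF: "finite F" unfolding F_def by (rule finite_box_vecs)
  obtain A where finA: "finite A" and A: "A \<subseteq> UNIV \<times> {1..}"
    and gal: "\<And>col. \<forall>x. col x < n \<Longrightarrow> \<exists>(a, D)\<in>A. \<exists>c. mono_homothet col F a D c"
    using gallai[OF finF, of n] unfolding gallai_set_def by metis
  \<comment> \<open>The pairs from Gallai's theorem may have zero coordinates in \<open>a\<close>;
    the shift by \<open>1\<close> moves the homothets into \<open>pos_vecs\<close>.\<close>
  define V1 where "V1 = (\<lambda>((a, D), u). 1 + (a + D *s u)) ` (A \<times> F)"
  define V2 where "V2 = (\<lambda>((a, D), y). D *s y) ` (A \<times> W)"
  have V1I: "1 + (a + D *s u) \<in> V1" if "(a, D) \<in> A" "u \<in> F" for a D u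
    using that unfolding V1_def by force
  have V2I: "D *s y \<in> V2" if "(a, D) \<in> A" "y \<in> W" for a D y
    using that unfolding V2_def by force
  show ?case
  proof (intro exI[of _ "V1 \<union> V2"] conjI allI impI)
    show "V1 \<union> V2 \<subseteq> pos_vecs"
      using A W(1) unfolding V1_def V2_def
      by (auto intro!: pos_vecs_add pos_vecs_scale one_pos_vecs)
    show "finite (V1 \<union> V2)"
      using finA finF W(2) unfolding V1_def V2_def by auto
    fix col :: "nat ^ 'd \<Rightarrow> nat" and S
    assume col: "\<forall>x\<in>pos_vecs. col x < n" and S: "finite S" "card S = Suc r"
      and sub: "col ` (V1 \<union> V2) \<subseteq> S"
    have "\<forall>x. col (1 + x) < n" using col pos_vecs_add[OF one_pos_vecs] by blast
    then obtain a D c where aD: "(a, D) \<in> A" and m: "mono_homothet (\<lambda>x. col (1 + x)) F a D c"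
      using gal[of "\<lambda>x. col (1 + x)"] by blast
    have D: "1 \<le> D" using aD A by auto
    \<comment> \<open>The offset \<open>0\<close> gives a point of \<open>V1\<close> coloured
      \<open>c\<close>. Hence deleting \<open>c\<close> really shrinks the palette in the second
      case below.\<close>
    have "c \<in> S"
      using bspec[OF m[unfolded mono_homothet_def] zeroF] V1I[OF aD zeroF] sub by auto
    show "\<exists>a b. mono_config col f k a b"
    proof (cases "\<exists>y\<in>W. col (D *s y) = c")
      case True
      then obtain y where y: "y \<in> W" "col (D *s y) = c" by blast
      have yp: "y \<in> pos_vecs" using y W(1) by blast
      have "(\<chi> j. i j * f (D *s y)) = D *s (\<chi> j. i j * f y)" for i :: "'d \<Rightarrow> nat"
        using semigroup_hom_scale[OF f yp D] by (simp add: vec_eq_iff)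
      then have "mono_config col f k (1 + a) (D *s y)"
        using m y inF[OF y(1)] pos_vecs_add[OF one_pos_vecs] pos_vecs_scale[OF yp D]
        unfolding mono_config_def mono_homothet_def by (simp add: add.assoc)
      then show ?thesis by blast
    next
      case False
      have "(\<lambda>x. col (D *s x)) ` W \<subseteq> S - {c}"
        using False sub V2I[OF aD] by blast
      moreover have "\<forall>x\<in>pos_vecs. col (D *s x) < n"
        using col pos_vecs_scale D by blast
      moreover have "finite (S - {c})" "card (S - {c}) = r"
        using S \<open>c \<in> S\<close> by auto
      ultimately obtain a' b' where "mono_config (\<lambda>x. col (D *s x)) f k a' b'"
        using IH[of "\<lambda>x. col (D *s x)" "S - {c}"] by blast
      then show ?thesis using mono_config_scale[OF f D] by blast
    qed
  qed
qed

section \<open>From colourings to partitions\<close>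

theorem corollary1p9:
  fixes f :: "nat ^ 'd \<Rightarrow> nat"
    and P :: "(nat ^ 'd) set set"
    and k :: nat
  assumes "semigroup_hom_on pos_vecs pos_nats f"
    and "finite P"
    and "partition_on pos_vecs P"
    and "k \<in> pos_nats"
  shows "\<exists>a\<in>pos_vecs. \<exists>b\<in>pos_vecs. \<exists>C\<in>P.
           {b} \<union> {a + (\<chi> j. i j * f b) | i :: 'd \<Rightarrow> nat. \<forall>j. 0 \<le> i j \<and> i j \<le> k} \<subseteq> C"
proof -
  have "\<forall>x\<in>pos_vecs. \<exists>C\<in>P. x \<in> C"
    using \<open>partition_on pos_vecs P\<close> unfolding partition_on_def by blast
  then obtain g where g: "\<And>x. x \<in> pos_vecs \<Longrightarrow> g x \<in> P" "\<And>x. x \<in> pos_vecs \<Longrightarrow> x \<in> g x"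
    by metis
  obtain h where h: "bij_betw h P {0..<card P}"
    using ex_bij_betw_finite_nat[OF \<open>finite P\<close>] by blast
  have bound: "h (g x) < card P" if "x \<in> pos_vecs" for x
    using bij_betwE[OF h] g(1)[OF that] by auto
  obtain W where "W \<subseteq> pos_vecs" and W: "\<And>col S. \<forall>x\<in>pos_vecs. col x < card P \<Longrightarrow>
      finite S \<Longrightarrow> card S = card P \<Longrightarrow> col ` W \<subseteq> S \<Longrightarrow> \<exists>a b. mono_config col f k a b"
    using brauer_colours[OF assms(1), of "card P" "card P" k] by metis
  have "\<exists>a b. mono_config (\<lambda>x. h (g x)) f k a b"
    \<comment> \<open>With the full palette \<open>{..<card P}\<close> the condition on the colours
      of \<open>W\<close> holds automatically.\<close>
    by (rule W[of _ "{..<card P}"]) (use bound \<open>W \<subseteq> pos_vecs\<close> in auto)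
  then obtain a b where ab: "a \<in> pos_vecs" "b \<in> pos_vecs"
    and same: "\<And>i. \<forall>j. i j \<le> k \<Longrightarrow> h (g (a + (\<chi> j. i j * f b))) = h (g b)"
    unfolding mono_config_def by blast
  \<comment> \<open>\<open>h\<close> is injective on the cells, so equal colours mean equal
    cells.\<close>
  have "a + (\<chi> j. i j * f b) \<in> g b" if "\<forall>j. i j \<le> k" for i
    using inj_onD[OF bij_betw_imp_inj_on[OF h] same[OF that]] g pos_vecs_add[OF ab(1)] ab(2)
    by metis
  then have "{b} \<union> {a + (\<chi> j. i j * f b) | i. \<forall>j. 0 \<le> i j \<and> i j \<le> k} \<subseteq> g b"
    using g(2)[OF ab(2)] by auto
  then show ?thesis using ab g(1)[OF ab(2)] by (intro bexI)
qed

end
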